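(* For all integers $m\geq 1$ and $n\geq 0$, \[ \overline{M}(m-1,n)\geq \overline{M}(m,n), \] except for $(m,n)=(1,1)$ and $(m,n)=(1,2)$.
   Context: Notation: $(a;q)_\infty=\prod_{j\geq 0}(1-aq^j)$ and $(a;q)_n=(a;q)_\infty/(aq^n;q)_\infty$. An overpartition of $n$ is a partition of $n$ in which the first occurrence of each part size may be overlined. The crank of an ordinary partition is its largest part if it has no parts equal to $1$, and otherwise the number of parts larger than the number of ones minus the number of ones. The first residual crank of an overpartition is the crank of the ordinary partition formed by its non-overlined parts. $\overline{M}(m,n)$ is the number of overpartitions of $n$ with first residual crank $m$, with the modification that an overpartition whose non-overlined parts consist of a single part $1$ contributes $-1$ to $\overline{M}(0,n)$ and $+1$ to each of $\overline{M}(-1,n)$ and $\overline{M}(1,n)$ (instead of contributing to crank $0$ normally). Equivalently, \[ \sum_{m=-\infty}^{\infty}\sum_{n\geq 0}\overline{M}(m,n)z^mq^n=\frac{(-q;q)_\infty(q;q)_\infty}{(zq;q)_\infty(q/z;q)_\infty}. \] *)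

theory Defs
  imports Main "HOL-Library.Multiset"
begin

definition partitions :: "nat \<Rightarrow> nat multiset set" where
  "partitions n = {P. 0 \<notin># P \<and> sum_mset P = n}"

text \<open>The largest part of the empty partition is taken to be \<open>0\<close>, so its crank is \<open>0\<close>.\<close>

definition crank :: "nat multiset \<Rightarrow> int" where
  "crank P =
    (if 1 \<notin># P then (if P = {#} then 0 else int (Max (set_mset P)))
     else int (size (filter_mset (\<lambda>p. p > count P 1) P)) - int (count P 1))"

text \<open>An overpartition is a pair \<open>(P, S)\<close>: the underlying partition \<open>P\<close> and the set \<open>S\<close>
  of those part sizes of \<open>P\<close> whose first occurrence is overlined.\<close>

type_synonym overpartition = "nat multiset \<times> nat set"

definition overpartitions :: "nat \<Rightarrow> overpartition set" where
  "overpartitions n = {(P, S). P \<in> partitions n \<and> S \<subseteq> set_mset P}"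

definition nonoverlined :: "overpartition \<Rightarrow> nat multiset" where
  "nonoverlined \<pi> = fst \<pi> - mset_set (snd \<pi>)"

definition first_residual_crank :: "overpartition \<Rightarrow> int" where
  "first_residual_crank \<pi> = crank (nonoverlined \<pi>)"

text \<open>Overpartitions whose non-overlined parts form the partition \<open>{#1#}\<close> are not counted by
  their crank; they have weight \<open>-1\<close> at \<open>m = 0\<close> and \<open>1\<close> at \<open>m = -1\<close> and \<open>m = 1\<close>.\<close>

definition Mbar :: "int \<Rightarrow> nat \<Rightarrow> int" where
  "Mbar m n =
    int (card {\<pi> \<in> overpartitions n. nonoverlined \<pi> \<noteq> {#1#} \<and> first_residual_crank \<pi> = m})
    + (if m = 0 then - 1 else if m = 1 \<or> m = - 1 then 1 else 0)
      * int (card {\<pi> \<in> overpartitions n. nonoverlined \<pi> = {#1#}})"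

lemma finite_partitions: "finite (partitions n)"
proof (rule finite_subset)
  show "partitions n \<subseteq> mset ` {xs. set xs \<subseteq> {..n} \<and> length xs \<le> n}"
  proof
    fix M assume "M \<in> partitions n"
    then have M: "0 \<notin># M" "sum_mset M = n" by (auto simp: partitions_def)
    obtain xs where xs: "mset xs = M" using ex_mset by blast
    have "length xs \<le> sum_list xs" if "0 \<notin> set xs" for xs :: "nat list"
      using that by (induction xs) auto
    moreover have "\<forall>x\<in>set xs. x \<le> sum_list xs"
      using member_le_sum_list by blast
    moreover have "sum_list xs = n" "0 \<notin> set xs"
      using M xs by (auto simp: sum_mset_sum_list[symmetric])
    ultimately show "M \<in> mset ` {xs. set xs \<subseteq> {..n} \<and> length xs \<le> n}"
      using xs by auto
  qed
  show "finite (mset ` {xs. set xs \<subseteq> {..n} \<and> length xs \<le> n})"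
    by (intro finite_imageI finite_lists_length_le) simp
qed

lemma finite_overpartitions: "finite (overpartitions n)"
proof -
  have "overpartitions n = (SIGMA M : partitions n. Pow (set_mset M))"
    by (auto simp: overpartitions_def)
  then show ?thesis by (simp add: finite_partitions)
qed

end

theory Submission
  imports Defs "HOL-Computational_Algebra.Formal_Power_Series"
begin

text \<open>
  Let \<open>(q)\<^sub>k = (1 - q) \<dots> (1 - q^k)\<close> and let \<open>A\<close> be the product of \<open>1 / (1 - q^j)\<close> over odd \<open>j \<ge> 3\<close>.
  Sorting partitions by their number \<open>w\<close> of ones turns the definition of the crank into a generating
  function. The overlined parts contribute \<open>A / (1 - q)\<close>, by Euler's theorem on distinct and odd
  parts, and for \<open>m \<ge> 0\<close> the generating function of \<open>Mbar m\<close> becomes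
  \<open>A * \<Sum>\<^sub>w q^(w^2 + (m + 2) w + m) / ((q)\<^sub>w (q)\<^bsub>m+w\<^esub>)\<close>.

  Hence that of \<open>Mbar (m - 1) - Mbar m\<close> is \<open>A * \<Sum>\<^sub>w T\<^sub>w (1 - q^(m + w) - q^(w + 1))\<close> with
  \<open>T\<^sub>w = q^(w^2 + (m + 1) w + m - 1) / ((q)\<^sub>w (q)\<^bsub>m+w\<^esub>)\<close>. These summands have coefficients of both
  signs, but \<open>T\<^sub>w q^(2 w + m + 2) = T\<^bsub>w+1\<^esub> (1 - q^(w + 1)) (1 - q^(m + w + 1))\<close> allows mass to be
  shifted between neighbouring summands until every factor with negative coefficients cancels
  against a factor of \<open>A\<close>, \<open>1 / (q)\<^sub>w\<close> or \<open>1 / (q)\<^bsub>m+w\<^esub>\<close>. The only summand that stays negative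
  somewhere is \<open>w = 0\<close> for \<open>m = 1\<close>, at \<open>q\<close> and \<open>q^2\<close>; its other coefficients are nonnegative by two
  injections between partitions into odd parts \<open>\<ge> 5\<close>.
\<close>

abbreviation q :: "int fps" where "q \<equiv> fps_X"

section \<open>Generating functions of weighted classes\<close>

definition fin_levels :: "'a set \<Rightarrow> ('a \<Rightarrow> nat) \<Rightarrow> bool" where
  "fin_levels X wt \<longleftrightarrow> (\<forall>n. finite {x \<in> X. wt x = n})"

text \<open>Coefficients are junk (\<open>card\<close> of an infinite set is \<open>0\<close>) unless \<open>fin_levels X wt\<close> holds.\<close>

definition gf :: "'a set \<Rightarrow> ('a \<Rightarrow> nat) \<Rightarrow> int fps" where
  "gf X wt = Abs_fps (\<lambda>n. int (card {x \<in> X. wt x = n}))"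

lemma gf_nth: "fps_nth (gf X wt) n = int (card {x \<in> X. wt x = n})"
  by (simp add: gf_def)

lemma fin_levels_subset:
  assumes "fin_levels Y wt" "X \<subseteq> Y"
  shows "fin_levels X wt"
  unfolding fin_levels_def
proof
  fix n
  have "{x \<in> X. wt x = n} \<subseteq> {x \<in> Y. wt x = n}" using assms(2) by auto
  then show "finite {x \<in> X. wt x = n}"
    using assms(1) by (auto simp: fin_levels_def intro: finite_subset)
qed

lemma gf_bij:
  assumes "bij_betw f X Y" and "\<And>x. x \<in> X \<Longrightarrow> wt' (f x) = wt x + c"
  shows "gf Y wt' = q ^ c * gf X wt"
proof (rule fps_ext)
  fix n
  show "fps_nth (gf Y wt') n = fps_nth (q ^ c * gf X wt) n"
  proof (cases "n < c")
    case True
    then have "{y \<in> Y. wt' y = n} = {}"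
      using assms by (auto simp: bij_betw_def)
    with True show ?thesis by (simp add: gf_nth fps_X_power_mult_nth del: Collect_empty_eq)
  next
    case False
    have "bij_betw f {x \<in> X. wt x = n - c} {y \<in> Y. wt' y = n}"
      using assms False unfolding bij_betw_def inj_on_def by force
    then have "card {x \<in> X. wt x = n - c} = card {y \<in> Y. wt' y = n}"
      by (rule bij_betw_same_card)
    with False show ?thesis by (simp add: gf_nth fps_X_power_mult_nth)
  qed
qed

lemma gf_Un:
  assumes "fin_levels X wt" "fin_levels Y wt" "X \<inter> Y = {}"
  shows "gf (X \<union> Y) wt = gf X wt + gf Y wt"
proof (rule fps_ext)
  fix n
  have "{x \<in> X \<union> Y. wt x = n} = {x \<in> X. wt x = n} \<union> {x \<in> Y. wt x = n}" by auto
  with assms show "fps_nth (gf (X \<union> Y) wt) n = fps_nth (gf X wt + gf Y wt) n"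
    by (simp add: gf_nth fin_levels_def) (subst card_Un_disjoint, auto)
qed

lemma gf_UN:
  assumes "finite I" "\<And>i. i \<in> I \<Longrightarrow> fin_levels (X i) wt"
    and "\<And>i j. i \<in> I \<Longrightarrow> j \<in> I \<Longrightarrow> i \<noteq> j \<Longrightarrow> X i \<inter> X j = {}"
  shows "gf (\<Union>i\<in>I. X i) wt = (\<Sum>i\<in>I. gf (X i) wt)"
proof (rule fps_ext)
  fix n
  have "{x \<in> \<Union>i\<in>I. X i. wt x = n} = (\<Union>i\<in>I. {x \<in> X i. wt x = n})" by auto
  moreover have "card (\<Union>i\<in>I. {x \<in> X i. wt x = n}) = (\<Sum>i\<in>I. card {x \<in> X i. wt x = n})"
    using assms by (intro card_UN_disjoint) (simp_all add: fin_levels_def, blast)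
  ultimately show "fps_nth (gf (\<Union>i\<in>I. X i) wt) n = fps_nth (\<Sum>i\<in>I. gf (X i) wt) n"
    by (simp add: gf_nth fps_sum_nth)
qed

lemma gf_Times:
  assumes "fin_levels X wt" "fin_levels Y wt'"
  shows "gf (X \<times> Y) (\<lambda>z. wt (fst z) + wt' (snd z)) = gf X wt * gf Y wt'"
proof (rule fps_ext)
  fix n
  have "{z \<in> X \<times> Y. wt (fst z) + wt' (snd z) = n}
      = (\<Union>i\<in>{0..n}. {x \<in> X. wt x = i} \<times> {y \<in> Y. wt' y = n - i})" by auto
  moreover have "card (\<Union>i\<in>{0..n}. {x \<in> X. wt x = i} \<times> {y \<in> Y. wt' y = n - i})
      = (\<Sum>i\<in>{0..n}. card ({x \<in> X. wt x = i} \<times> {y \<in> Y. wt' y = n - i}))"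
    using assms by (intro card_UN_disjoint) (auto simp: fin_levels_def)
  ultimately show "fps_nth (gf (X \<times> Y) (\<lambda>z. wt (fst z) + wt' (snd z))) n
      = fps_nth (gf X wt * gf Y wt') n"
    by (simp add: gf_nth fps_mult_nth card_cartesian_product)
qed

section \<open>Partitions with parts in a prescribed set\<close>

definition parts_in :: "nat set \<Rightarrow> nat multiset set" where
  "parts_in S = {P. set_mset P \<subseteq> S}"

definition pgf :: "nat set \<Rightarrow> int fps" where
  "pgf S = gf (parts_in S) sum_mset"

lemma fin_levels_parts: "0 \<notin> S \<Longrightarrow> fin_levels (parts_in S) sum_mset"
  unfolding fin_levels_def parts_in_def
  by (intro allI finite_subset[OF _ finite_partitions]) (auto simp: partitions_def)

text \<open>Zero parts are allowed here, so finiteness comes from the fixed size;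
  \<open>gf_size_eq\<close> is about such multisets.\<close>

lemma finite_size_sum: "finite {P :: nat multiset. size P = j \<and> sum_mset P = n}"
proof (rule finite_subset)
  show "{P :: nat multiset. size P = j \<and> sum_mset P = n}
      \<subseteq> mset ` {xs. set xs \<subseteq> {..n} \<and> length xs = j}"
  proof
    fix P :: "nat multiset"
    assume P: "P \<in> {P. size P = j \<and> sum_mset P = n}"
    obtain xs where xs: "mset xs = P" using ex_mset by blast
    have "\<forall>x\<in>set xs. x \<le> sum_list xs" using member_le_sum_list by blast
    with P xs show "P \<in> mset ` {xs. set xs \<subseteq> {..n} \<and> length xs = j}"
      by (force simp flip: sum_mset_sum_list)
  qed
  show "finite (mset ` {xs. set xs \<subseteq> {..n} \<and> length xs = j})"
    by (intro finite_imageI finite_lists_length_eq) simp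
qed

lemma pgf_empty [simp]: "pgf {} = 1"
proof (rule fps_ext)
  fix n
  have "{x \<in> parts_in {}. sum_mset x = n} = (if n = 0 then {{#}} else {})"
    by (auto simp: parts_in_def)
  then show "fps_nth (pgf {}) n = fps_nth 1 n" by (simp add: pgf_def gf_nth)
qed

text \<open>Deleting one copy of \<open>k\<close> maps the partitions containing \<open>k\<close>
  onto all partitions with parts in \<open>S\<close>. Every later cancellation of a factor
  \<open>1 - q ^ k\<close> rests on this, so that no infinite product has to be formed.\<close>

lemma pgf_remove:
  assumes "0 \<notin> S" "k \<in> S"
  shows "(1 - q ^ k) * pgf S = pgf (S - {k})"
proof -
  let ?Y = "{P \<in> parts_in S. k \<in># P}"
  have split: "parts_in S = parts_in (S - {k}) \<union> ?Y" by (auto simp: parts_in_def)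
  have "bij_betw (add_mset k) (parts_in S) ?Y"
    using assms by (intro bij_betwI[where g = "\<lambda>P. P - {#k#}"])
      (auto simp: parts_in_def dest: in_diffD)
  then have Y: "gf ?Y sum_mset = q ^ k * pgf S"
    unfolding pgf_def by (rule gf_bij) simp
  have "gf (parts_in (S - {k}) \<union> ?Y) sum_mset = gf (parts_in (S - {k})) sum_mset + gf ?Y sum_mset"
    by (intro gf_Un fin_levels_subset[OF fin_levels_parts[OF assms(1)]]) (auto simp: parts_in_def)
  then have "pgf S = pgf (S - {k}) + q ^ k * pgf S"
    using Y split[symmetric] by (simp add: pgf_def)
  then show ?thesis by (simp add: algebra_simps)
qed

lemma pgf_Un:
  assumes "0 \<notin> S" "0 \<notin> T" "S \<inter> T = {}"
  shows "pgf (S \<union> T) = pgf S * pgf T"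
proof -
  have "bij_betw (\<lambda>(P, R). P + R) (parts_in S \<times> parts_in T) (parts_in (S \<union> T))"
  proof (rule bij_betwI[where g = "\<lambda>P. (filter_mset (\<lambda>x. x \<in> S) P, filter_mset (\<lambda>x. x \<in> T) P)"])
    fix z assume "z \<in> parts_in S \<times> parts_in T"
    then obtain P R where z: "z = (P, R)" "set_mset P \<subseteq> S" "set_mset R \<subseteq> T"
      by (auto simp: parts_in_def)
    have 1: "filter_mset (\<lambda>x. x \<in> S) P = P" "filter_mset (\<lambda>x. x \<in> T) R = R"
      using z by (auto simp: filter_mset_eq_conv)
    have 2: "filter_mset (\<lambda>x. x \<in> T) P = {#}" "filter_mset (\<lambda>x. x \<in> S) R = {#}"
      using z assms by auto
    show "(filter_mset (\<lambda>x. x \<in> S) (case z of (P, R) \<Rightarrow> P + R),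
           filter_mset (\<lambda>x. x \<in> T) (case z of (P, R) \<Rightarrow> P + R)) = z"
      using z 1 2 by simp
  next
    fix P assume "P \<in> parts_in (S \<union> T)"
    then show "(case (filter_mset (\<lambda>x. x \<in> S) P, filter_mset (\<lambda>x. x \<in> T) P) of (P, R) \<Rightarrow> P + R) = P"
      using assms by (auto simp: parts_in_def multiset_eq_iff count_eq_zero_iff)
  qed (auto simp: parts_in_def)
  then have "gf (parts_in (S \<union> T)) sum_mset
      = q ^ 0 * gf (parts_in S \<times> parts_in T) (\<lambda>z. sum_mset (fst z) + sum_mset (snd z))"
    by (rule gf_bij) auto
  then show ?thesis using assms
    by (simp add: pgf_def gf_Times fin_levels_parts)
qed

section \<open>Distinct parts and odd parts\<close>

definition distinct_gf :: "int fps" where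
  "distinct_gf = gf {S. finite S \<and> 0 \<notin> S} (\<lambda>S. \<Sum>S)"

lemma fin_levels_distinct: "fin_levels {S. finite S \<and> 0 \<notin> S} (\<lambda>S. \<Sum>S :: nat)"
  unfolding fin_levels_def
proof
  fix n :: nat
  have le: "x \<le> \<Sum>S" if "finite S" "x \<in> S" for x :: nat and S
    using member_le_sum[OF that(2), of "\<lambda>x. x"] that(1) by simp
  have "{S \<in> {S. finite S \<and> 0 \<notin> S}. \<Sum>S = n} \<subseteq> Pow {..n}"
    by (auto intro: le)
  then show "finite {S \<in> {S. finite S \<and> 0 \<notin> S}. \<Sum>S = n}"
    by (rule finite_subset) simp
qed

text \<open>Halve every part. The doubled weight on the right is that of two copies of a
  partition.\<close>

lemma pgf_even: "pgf {k. even k \<and> k > 0} = gf (parts_in {0<..}) (\<lambda>P. 2 * sum_mset P)"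
proof -
  have "bij_betw (image_mset (\<lambda>k. 2 * k)) (parts_in {0<..}) (parts_in {k. even k \<and> k > 0})"
    by (intro bij_betwI[where g = "image_mset (\<lambda>k. k div 2)"])
      (auto simp: parts_in_def subset_iff image_mset.compositionality o_def div_greater_zero_iff
        intro!: multiset.map_ident_strong dvd_imp_le)
  then have "gf (parts_in {k. even k \<and> k > 0}) sum_mset
      = q ^ 0 * gf (parts_in {0<..}) (\<lambda>P. 2 * sum_mset P)"
  proof (rule gf_bij)
    show "sum_mset (image_mset (\<lambda>k. 2 * k) P) = 2 * sum_mset P + 0" for P :: "nat multiset"
      by (induction P) auto
  qed
  then show ?thesis by (simp add: pgf_def)
qed

text \<open>Multiplicities are halved, not parts: this undoes \<open>R + R\<close> and ignores an
  odd copy left over.\<close>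

definition halve :: "nat multiset \<Rightarrow> nat multiset" where
  "halve P = Abs_multiset (\<lambda>k. count P k div 2)"

lemma count_halve [simp]: "count (halve P) k = count P k div 2"
proof -
  have "{k. 0 < count P k div 2} \<subseteq> set_mset P"
    by (metis (mono_tags, lifting) count_eq_zero_iff div_0 less_irrefl mem_Collect_eq subsetI)
  then have "finite {k. 0 < count P k div 2}" by (rule finite_subset) simp
  then show ?thesis by (simp add: halve_def count_Abs_multiset)
qed

lemma finite_odd_count: "finite {k. odd (count P k)}"
proof (rule finite_subset)
  show "{k. odd (count P k)} \<subseteq> set_mset P"
    by (metis (mono_tags, lifting) count_eq_zero_iff even_zero mem_Collect_eq subsetI)
qed simp

lemma parts_in_pos_iff: "P \<in> parts_in {0<..} \<longleftrightarrow> count P 0 = 0"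
  unfolding parts_in_def by (auto simp: count_eq_zero_iff intro!: gr0I)

text \<open>Every partition is uniquely a set plus two copies of a partition, so the series of all
  partitions is \<open>distinct_gf\<close> times that of partitions into even parts.\<close>

lemma euler_distinct_odd: "distinct_gf = pgf {k. odd k}"
proof -
  let ?f = "\<lambda>(S, R). mset_set S + R + R"
  let ?X = "{S. finite S \<and> (0::nat) \<notin> S} \<times> parts_in {0<..}"
  have "bij_betw ?f ?X (parts_in {0<..})"
  proof (rule bij_betwI[where g = "\<lambda>P. ({k. odd (count P k)}, halve P)"])
    show "?f \<in> ?X \<rightarrow> parts_in {0<..}"
      by (auto simp: parts_in_pos_iff)
    show "(\<lambda>P. ({k. odd (count P k)}, halve P)) \<in> parts_in {0<..} \<rightarrow> ?X"
      by (auto simp: parts_in_pos_iff finite_odd_count)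
  next
    fix z assume "z \<in> ?X"
    then obtain S R where z: "z = (S, R)" and S: "finite S" by auto
    have c: "count (mset_set S + R + R) k = (if k \<in> S then 1 else 0) + 2 * count R k" for k
      using S by (simp add: count_mset_set')
    have "{k. odd (count (mset_set S + R + R) k)} = S" unfolding c by auto
    moreover have "halve (mset_set S + R + R) = R"
      by (rule multiset_eqI) (simp only: count_halve c, simp)
    ultimately show "({k. odd (count (?f z) k)}, halve (?f z)) = z" by (simp add: z)
  next
    fix P :: "nat multiset"
    have "(if odd c then 1 else 0) + c div 2 + c div 2 = c" for c :: nat by presburger
    then show "?f ({k. odd (count P k)}, halve P) = P"
      by (intro multiset_eqI) (simp add: count_mset_set' finite_odd_count)
  qed
  then have "gf (parts_in {0<..}) sum_mset = q ^ 0 * gf ?X (\<lambda>z. \<Sum>(fst z) + 2 * sum_mset (snd z))"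
    by (rule gf_bij) (auto simp: sum_unfold_sum_mset)
  moreover have "fin_levels (parts_in {0<..}) (\<lambda>P. 2 * sum_mset P)"
    unfolding fin_levels_def
  proof
    fix n
    have "finite {P \<in> parts_in {0<..}. sum_mset P = n div 2}"
      using fin_levels_parts[of "{0<..}"] by (simp add: fin_levels_def)
    then show "finite {P \<in> parts_in {0<..}. 2 * sum_mset P = n}"
      by (rule finite_subset[rotated]) auto
  qed
  ultimately have "pgf {0<..} = distinct_gf * pgf {k. even k \<and> k > 0}"
    using gf_Times[OF fin_levels_distinct, of "parts_in {0<..}" "\<lambda>P. 2 * sum_mset P"]
    by (simp add: pgf_def[of "{0<..}"] distinct_gf_def pgf_even)
  moreover have "pgf {0<..} = pgf {k. odd k} * pgf {k. even k \<and> k > 0}"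
  proof -
    have "{0<..} = {k. odd k} \<union> {k :: nat. even k \<and> k > 0}" by (auto elim: oddE intro!: gr0I)
    then show ?thesis using pgf_Un[of "{k. odd k}" "{k. even k \<and> k > 0}"] by auto
  qed
  \<comment> \<open>Both factorizations of \<open>pgf {0<..}\<close> share this factor, which can be
    cancelled because it is nonzero.\<close>
  moreover have "pgf {k. even k \<and> k > 0} \<noteq> 0"
  proof -
    have "{P \<in> parts_in {k. even k \<and> k > 0}. sum_mset P = 0} = {{#}}"
      by (auto simp: parts_in_def)
        (metis (mono_tags, lifting) less_irrefl mem_Collect_eq multiset_nonemptyE subsetD)
    then have "fps_nth (pgf {k. even k \<and> k > 0}) 0 = 1" by (simp add: pgf_def gf_nth)
    then show ?thesis by auto
  qed
  ultimately show ?thesis by (metis mult_right_cancel)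
qed

text \<open>With zeros as padding, these multisets are the partitions into at most \<open>j\<close>
  parts. The recursion of \<open>pgf {1..j}\<close> in \<open>j\<close> is matched by deleting a
  part \<open>0\<close> or, if there is none, lowering all parts by one.\<close>

lemma gf_size_eq: "gf {P :: nat multiset. size P = j} sum_mset = pgf {1..j}"
proof (induction j)
  case 0
  have "{P :: nat multiset. size P = 0} = parts_in {}" by (auto simp: parts_in_def)
  then show ?case using pgf_empty by (simp add: pgf_def)
next
  case (Suc j)
  let ?Z = "\<lambda>j. {P :: nat multiset. size P = j}"
  let ?X = "{P \<in> ?Z (Suc j). 0 \<in># P}" and ?Y = "{P \<in> ?Z (Suc j). 0 \<notin># P}"
  have fin: "fin_levels (?Z j) sum_mset" for j
    using finite_size_sum by (simp add: fin_levels_def)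
  have "bij_betw (add_mset 0) (?Z j) ?X"
    by (intro bij_betwI[where g = "\<lambda>P. P - {#0#}"]) (auto simp: size_Diff_singleton)
  then have X: "gf ?X sum_mset = q ^ 0 * gf (?Z j) sum_mset" by (rule gf_bij) simp
  have "bij_betw (image_mset Suc) (?Z (Suc j)) ?Y"
    by (intro bij_betwI[where g = "image_mset (\<lambda>k. k - 1)"])
      (auto simp: image_mset.compositionality o_def intro!: multiset.map_ident_strong
        simp del: One_nat_def intro: Suc_pred' gr0I, metis Suc_pred gr0I One_nat_def)
  then have Y: "gf ?Y sum_mset = q ^ Suc j * gf (?Z (Suc j)) sum_mset"
  proof (rule gf_bij)
    have "sum_mset (image_mset Suc P) = sum_mset P + size P" for P by (induction P) auto
    then show "sum_mset (image_mset Suc P) = sum_mset P + Suc j" if "P \<in> ?Z (Suc j)" for P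
      using that by simp
  qed
  have "?Z (Suc j) = ?X \<union> ?Y" by auto
  moreover have "gf (?X \<union> ?Y) sum_mset = gf ?X sum_mset + gf ?Y sum_mset"
    by (rule gf_Un) (auto intro: fin_levels_subset[OF fin[of "Suc j"]])
  ultimately have "gf (?Z (Suc j)) sum_mset
      = gf (?Z j) sum_mset + q ^ Suc j * gf (?Z (Suc j)) sum_mset"
    using X Y by (metis (no_types, lifting) mult_1 power_0)
  then have "(1 - q ^ Suc j) * gf (?Z (Suc j)) sum_mset = gf (?Z j) sum_mset"
    by (metis (no_types, lifting) add_diff_cancel_right' left_diff_distrib mult_1)
  also have "\<dots> = (1 - q ^ Suc j) * pgf {1..Suc j}"
  proof -
    have "{1..Suc j} - {Suc j} = {1..j}" by auto
    then show ?thesis using Suc pgf_remove[of "{1..Suc j}" "Suc j"] by simp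
  qed
  finally have eq: "(1 - q ^ Suc j) * gf (?Z (Suc j)) sum_mset = (1 - q ^ Suc j) * pgf {1..Suc j}" .
  have "fps_nth (1 - q ^ Suc j :: int fps) 0 \<noteq> 0" by simp
  then have "(1 - q ^ Suc j :: int fps) \<noteq> 0" by (metis fps_zero_nth)
  with eq show ?case by simp
qed

text \<open>Subtracting \<open>Suc w\<close> from each part leaves an arbitrary multiset of size
  \<open>j\<close>, zeros included.\<close>

lemma gf_size_gt:
  "gf {P. size P = j \<and> (\<forall>x\<in>#P. w < x)} sum_mset = q ^ (Suc w * j) * pgf {1..j}"
proof -
  have "bij_betw (image_mset ((+) (Suc w))) {P :: nat multiset. size P = j}
      {P. size P = j \<and> (\<forall>x\<in>#P. w < x)}"
    by (intro bij_betwI[where g = "image_mset (\<lambda>k. k - Suc w)"])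
      (auto simp: image_mset.compositionality o_def Suc_le_eq intro!: multiset.map_ident_strong)
  then have "gf {P. size P = j \<and> (\<forall>x\<in>#P. w < x)} sum_mset
      = q ^ (Suc w * j) * gf {P :: nat multiset. size P = j} sum_mset"
  proof (rule gf_bij)
    have "sum_mset (image_mset ((+) (Suc w)) P) = sum_mset P + Suc w * size P" for P
      by (induction P) auto
    then show "sum_mset (image_mset ((+) (Suc w)) P) = sum_mset P + Suc w * j"
      if "P \<in> {P. size P = j}" for P using that by simp
  qed
  then show ?thesis by (simp only: gf_size_eq)
qed

section \<open>Coefficientwise nonnegativity\<close>

lemma sum_mset_remove: "x \<in># P \<Longrightarrow> x + sum_mset (P - {#x#}) = sum_mset P" for x :: nat
  by (drule multi_member_split) auto

text \<open>\<open>pgf (odd_from 3)\<close> is the product \<open>A\<close>, and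
  \<open>pgf (odd_from 5)\<close> is \<open>(1 - q^3) * A\<close>.\<close>

definition odd_from :: "nat \<Rightarrow> nat set" where
  "odd_from k = {j. odd j \<and> k \<le> j}"

lemma odd_from_iff [simp]: "j \<in> odd_from k \<longleftrightarrow> odd j \<and> k \<le> j"
  by (simp add: odd_from_def)

definition nonneg :: "int fps \<Rightarrow> bool" where
  "nonneg f \<longleftrightarrow> (\<forall>n. fps_nth f n \<ge> 0)"

lemma nonneg_add: "nonneg f \<Longrightarrow> nonneg g \<Longrightarrow> nonneg (f + g)"
  by (simp add: nonneg_def)

lemma nonneg_sum: "(\<And>i. i \<in> I \<Longrightarrow> nonneg (f i)) \<Longrightarrow> nonneg (\<Sum>i\<in>I. f i)"
  by (auto simp: nonneg_def fps_sum_nth intro: sum_nonneg)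

lemma nonneg_mult: "nonneg f \<Longrightarrow> nonneg g \<Longrightarrow> nonneg (f * g)"
  by (auto simp: nonneg_def fps_mult_nth intro!: sum_nonneg)

lemma nonneg_X_power: "nonneg (q ^ k)"
  by (simp add: nonneg_def fps_X_power_nth)

lemma nonneg_pgf: "nonneg (pgf S)"
  by (simp add: nonneg_def pgf_def gf_nth)

lemma nonneg_pgf_remove: "0 \<notin> S \<Longrightarrow> k \<in> S \<Longrightarrow> nonneg ((1 - q ^ k) * pgf S)"
  by (simp add: pgf_remove nonneg_pgf)

lemma nonneg_pgf_remove2:
  assumes "0 \<notin> S" "k \<in> S" "l \<in> S" "k \<noteq> l"
  shows "nonneg ((1 - q ^ k) * ((1 - q ^ l) * pgf S))"
  using assms by (simp add: pgf_remove nonneg_pgf)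

section \<open>Partitions into odd parts at least 5\<close>

lemma pgf_odd_from_3: "(1 - q ^ 3) * pgf (odd_from 3) = pgf (odd_from 5)"
proof -
  have "odd_from 3 - {3} = odd_from 5"
  proof -
    have "odd j \<and> 3 \<le> j \<and> j \<noteq> 3 \<longleftrightarrow> odd j \<and> 5 \<le> j" for j :: nat by presburger
    then show ?thesis by (auto simp: odd_from_def)
  qed
  then show ?thesis using pgf_remove[of "odd_from 3" 3] by simp
qed

text \<open>Nonempty partitions into odd parts at least \<open>5\<close>, as pairs (largest part, other parts).\<close>

definition topped :: "nat \<Rightarrow> (nat \<times> nat multiset) set" where
  "topped N = {(M, R). M \<in> odd_from 5 \<and> set_mset R \<subseteq> odd_from 5 \<and> (\<forall>x\<in>#R. x \<le> M)
     \<and> M + sum_mset R = N}"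

lemma bij_topped:
  assumes "N > 0"
  shows "bij_betw (\<lambda>(M, R). add_mset M R) (topped N) {P \<in> parts_in (odd_from 5). sum_mset P = N}"
proof (rule bij_betwI[where g = "\<lambda>P. (Max (set_mset P), P - {#Max (set_mset P)#})"])
  have Mx: "Max (insert M (set_mset R)) = M" if "\<forall>x\<in>#R. x \<le> M" for M :: nat and R
    using that by (intro Max_eqI) auto
  show "(\<lambda>(M, R). add_mset M R) \<in> topped N \<rightarrow> {P \<in> parts_in (odd_from 5). sum_mset P = N}"
    by (auto simp: topped_def parts_in_def)
  show "(\<lambda>P. (Max (set_mset P), P - {#Max (set_mset P)#}))
      \<in> {P \<in> parts_in (odd_from 5). sum_mset P = N} \<rightarrow> topped N"
  proof
    fix P assume P: "P \<in> {P \<in> parts_in (odd_from 5). sum_mset P = N}"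
    then have "P \<noteq> {#}" using assms by auto
    then have M: "Max (set_mset P) \<in># P" by (intro Max_in) auto
    have "Max (set_mset P) + sum_mset (P - {#Max (set_mset P)#}) = sum_mset P"
      using M by (rule sum_mset_remove)
    moreover have "x \<le> Max (set_mset P)" if "x \<in># P" for x using that by simp
    moreover have "x \<in># P" if "x \<in># P - {#Max (set_mset P)#}" for x
      using that by (rule in_diffD)
    moreover have "x \<in> odd_from 5" if "x \<in># P" for x using that P by (auto simp: parts_in_def)
    ultimately show "(Max (set_mset P), P - {#Max (set_mset P)#}) \<in> topped N"
      using P M unfolding topped_def by blast
  qed
  show "(Max (set_mset (case z of (M, R) \<Rightarrow> add_mset M R)),
      (case z of (M, R) \<Rightarrow> add_mset M R) - {#Max (set_mset (case z of (M, R) \<Rightarrow> add_mset M R))#}) = z"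
    if "z \<in> topped N" for z
    using that by (auto simp: topped_def Mx)
  show "(case (Max (set_mset P), P - {#Max (set_mset P)#}) of (M, R) \<Rightarrow> add_mset M R) = P"
    if "P \<in> {P \<in> parts_in (odd_from 5). sum_mset P = N}" for P
  proof -
    have "P \<noteq> {#}" using that assms by auto
    then have "Max (set_mset P) \<in># P" by (intro Max_in) auto
    then show ?thesis by simp
  qed
qed

lemma pgf_odd_from_5_nth: "N > 0 \<Longrightarrow> fps_nth (pgf (odd_from 5)) N = int (card (topped N))"
  using bij_betw_same_card[OF bij_topped] by (simp add: pgf_def gf_nth)

lemma pgf_odd_from_5_nth_0: "fps_nth (pgf (odd_from 5)) 0 = 1"
proof -
  have "{P \<in> parts_in (odd_from 5). sum_mset P = 0} = {{#}}"
    by (auto simp: parts_in_def) (metis odd_from_iff multiset_nonemptyE not_numeral_le_zero subsetD)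
  then show ?thesis by (simp add: pgf_def gf_nth)
qed

lemma finite_topped: "N > 0 \<Longrightarrow> finite (topped N)"
  using bij_betw_finite[OF bij_topped] fin_levels_parts[of "odd_from 5"] by (simp add: fin_levels_def)

text \<open>Raising the largest part by 2 keeps it odd and largest.\<close>

lemma topped_mono: "N > 0 \<Longrightarrow> card (topped N) \<le> card (topped (N + 2))"
proof (rule card_inj_on_le[where f = "\<lambda>(M, R). (M + 2, R)"])
  show "(\<lambda>(M, R). (M + 2, R)) ` topped N \<subseteq> topped (N + 2)"
    by (auto simp: topped_def intro: le_SucI)
qed (auto simp: inj_on_def intro: finite_topped)

text \<open>If the largest part \<open>M\<close> occurs once it is lowered by \<open>2\<close>; otherwise two copies of it are
  replaced by \<open>2 * M - 5\<close>.\<close>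

lemma topped_bound:
  assumes "N \<ge> 6"
  shows "card (topped N) \<le> card (topped (N - 2)) + card (topped (N - 5))"
proof -
  let ?U = "{(M, R) \<in> topped N. M \<notin># R}" and ?V = "{(M, R) \<in> topped N. M \<in># R}"
  have "card ?U \<le> card (topped (N - 2))"
  proof (rule card_inj_on_le[where f = "\<lambda>(M, R). (M - 2, R)"])
    show "inj_on (\<lambda>(M, R). (M - 2, R)) ?U" by (auto simp: inj_on_def topped_def)
    show "(\<lambda>(M, R). (M - 2, R)) ` ?U \<subseteq> topped (N - 2)"
    proof clarify
      fix M R assume MR: "(M, R) \<in> topped N" "M \<notin># R"
      have R: "odd x \<and> 5 \<le> x \<and> x \<le> M \<and> x \<noteq> M" if "x \<in># R" for x
        using MR that by (auto simp: topped_def)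
      have M: "odd M" "5 \<le> M" using MR by (auto simp: topped_def)
      \<comment> \<open>If \<open>M = 5\<close> occurred only once, no other part would be possible
        and \<open>N\<close> would be 5. Hence \<open>M - 2\<close> is still at least 5.\<close>
      have "M \<noteq> 5"
      proof
        assume "M = 5"
        then have "x \<notin># R" for x using R[of x] by auto
        then have "R = {#}" by (meson multiset_nonemptyE)
        with MR \<open>M = 5\<close> assms show False by (simp add: topped_def)
      qed
      moreover have "x \<le> M - 2" if "x \<in># R" for x using R[OF that] M by presburger
      moreover have "M \<noteq> 6" using M by auto
      ultimately show "(M - 2, R) \<in> topped (N - 2)"
        using MR M by (auto simp: topped_def)
    qed
    show "finite (topped (N - 2))" using assms by (intro finite_topped) auto
  qed
  moreover have "card ?V \<le> card (topped (N - 5))"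
  \<comment> \<open>\<open>2 * M - 5\<close> is odd and, as \<open>M \<ge> 5\<close>, at least
    \<open>M\<close>, so it can serve as the new largest part.\<close>
  proof (rule card_inj_on_le[where f = "\<lambda>(M, R). (2 * M - 5, R - {#M#})"])
    show "inj_on (\<lambda>(M, R). (2 * M - 5, R - {#M#})) ?V"
    proof (rule inj_on_inverseI[where g = "\<lambda>(M, R). ((M + 5) div 2, add_mset ((M + 5) div 2) R)"])
      fix z assume "z \<in> ?V"
      then obtain M R where "z = (M, R)" "5 \<le> M" "M \<in># R" by (auto simp: topped_def)
      then show "(\<lambda>(M, R). ((M + 5) div 2, add_mset ((M + 5) div 2) R))
          ((\<lambda>(M, R). (2 * M - 5, R - {#M#})) z) = z" by simp
    qed
    show "(\<lambda>(M, R). (2 * M - 5, R - {#M#})) ` ?V \<subseteq> topped (N - 5)"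
    proof clarify
      fix M R assume MR: "(M, R) \<in> topped N" "M \<in># R"
      have "M + sum_mset (R - {#M#}) = sum_mset R"
        using MR(2) by (rule sum_mset_remove)
      moreover have "x \<le> 2 * M - 5" if "x \<in># R - {#M#}" for x
        using MR in_diffD[OF that] by (force simp: topped_def)
      ultimately show "(2 * M - 5, R - {#M#}) \<in> topped (N - 5)"
        using MR by (auto simp: topped_def dest: in_diffD)
    qed
    show "finite (topped (N - 5))" using assms by (intro finite_topped) auto
  qed
  moreover have "card (topped N) \<le> card ?U + card ?V"
  proof -
    have "topped N = ?U \<union> ?V" by auto
    then show ?thesis by (metis (no_types, lifting) card_Un_le)
  qed
  ultimately show ?thesis by linarith
qed

lemma topped_small: "N < 5 \<Longrightarrow> topped N = {}"
  by (auto simp: topped_def)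

lemma topped_lt_10:
  assumes "(M, R) \<in> topped N" "N < 10"
  shows "M = N" "R = {#}"
proof -
  show "R = {#}"
  proof (rule ccontr)
    assume "R \<noteq> {#}"
    then obtain x where x: "x \<in># R" by blast
    then have "x + sum_mset (R - {#x#}) = sum_mset R" by (rule sum_mset_remove)
    moreover have "5 \<le> x" "5 \<le> M" "M + sum_mset R = N" using assms x by (auto simp: topped_def)
    ultimately show False using assms by linarith
  qed
  then show "M = N" using assms by (simp add: topped_def)
qed

text \<open>With \<open>b\<close> the coefficients of \<open>pgf (odd_from 5)\<close>, the
  coefficient at \<open>n\<close> is
  \<open>b n - b (n - 1) - b (n - 2) + b (n - 3) + b (n - 6)\<close>, terms of negative index being
  0. \<open>topped_mono\<close> bounds \<open>b (n - 2)\<close> by \<open>b n\<close>, and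
  \<open>topped_bound\<close> bounds \<open>b (n - 1)\<close> by the other two. The series is
  \<open>A\<close> times the shifted summand \<open>w = 0\<close> for \<open>m = 1\<close>.\<close>

lemma pgf_odd_from_5_second_difference:
  defines "f \<equiv> pgf (odd_from 5) * ((1 - q) * (1 - q ^ 2) + q ^ 6)"
  shows "n \<notin> {1, 2} \<Longrightarrow> fps_nth f n \<ge> 0" and "n \<in> {1, 2} \<Longrightarrow> fps_nth f n < 0"
proof -
  define b where "b = fps_nth (pgf (odd_from 5))"
  have f: "f = pgf (odd_from 5) - q ^ 1 * pgf (odd_from 5) - q ^ 2 * pgf (odd_from 5)
      + q ^ 3 * pgf (odd_from 5) + q ^ 6 * pgf (odd_from 5)"
    by (simp add: f_def algebra_simps eval_nat_numeral)
  have fn: "fps_nth f n = b n - (if n < 1 then 0 else b (n - 1)) - (if n < 2 then 0 else b (n - 2))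
      + (if n < 3 then 0 else b (n - 3)) + (if n < 6 then 0 else b (n - 6))" for n
    unfolding f fps_add_nth fps_sub_nth fps_X_power_mult_nth b_def by simp
  have b0: "b 0 = 1" by (simp add: b_def pgf_odd_from_5_nth_0)
  have b: "b N = int (card (topped N))" if "N > 0" for N
    using that by (simp add: b_def pgf_odd_from_5_nth)
  have small: "b N = 0" if "0 < N" "N < 5" for N using that by (simp add: b topped_small)
  have b6: "b 6 = 0"
  proof -
    have "z \<notin> topped 6" for z
    proof
      assume z: "z \<in> topped 6"
      then have "fst z = 6" using topped_lt_10[of "fst z" "snd z" 6] by simp
      moreover have "odd (fst z)" using z by (auto simp: topped_def)
      ultimately show False by simp
    qed
    then have "topped 6 = {}" by blast
    then show ?thesis by (simp add: b)
  qed
  have bnn: "b N \<ge> 0" for N using b[of N] b0 by (cases "N = 0") auto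
  show "fps_nth f n < 0" if "n \<in> {1, 2}"
    using that by (auto simp: fn b0 small)
  show "fps_nth f n \<ge> 0" if n: "n \<notin> {1, 2}"
  proof (cases "n \<ge> 7")
    \<comment> \<open>All indices are now positive, as the description by \<open>topped\<close>
      requires: \<open>b 0 = 1\<close>, but \<open>topped 0\<close> is empty.\<close>
    case True
    have n2: "n - 2 + 2 = n" using True by simp
    have "b (n - 2) \<le> b n"
      using topped_mono[of "n - 2", unfolded n2] True by (simp add: b)
    moreover have "b (n - 1) \<le> b (n - 3) + b (n - 6)"
    proof -
      have "card (topped (n - 1)) \<le> card (topped (n - 1 - 2)) + card (topped (n - 1 - 5))"
        using True by (intro topped_bound) simp
      moreover have "n - 1 - 2 = n - 3" "n - 1 - 5 = n - 6" using True by auto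
      ultimately have "card (topped (n - 1)) \<le> card (topped (n - 3)) + card (topped (n - 6))" by simp
      then show ?thesis using True by (simp add: b)
    qed
    ultimately show ?thesis using True by (simp add: fn)
  next
    case False
    with n consider "n = 0" | "n = 3" | "n = 4" | "n = 5" | "n = 6" by force
    then show ?thesis
    proof cases
      \<comment> \<open>Here \<open>n = 6\<close>: \<open>b 0 = 1\<close> makes up for
        \<open>b 5\<close>, which is at most 1.\<close>
      case 5
      have "z = (5, {#})" if "z \<in> topped 5" for z
        using topped_lt_10[of "fst z" "snd z" 5] that by (cases z) simp
      then have "topped 5 \<subseteq> {(5, {#})}" by blast
      then have "card (topped 5) \<le> card {(5 :: nat, {#} :: nat multiset)}" by (intro card_mono) auto
      then have "b 5 \<le> 1" by (simp add: b)
      then show ?thesis using 5 by (simp add: fn b0 small b6)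
    qed (simp_all add: fn b0 small bnn)
  qed
qed

section \<open>Telescoping\<close>

text \<open>This is \<open>1 / (q)\<^sub>k\<close>.\<close>

definition pgf_upto :: "nat \<Rightarrow> int fps" where
  "pgf_upto k = pgf {1..k}"

lemma pgf_upto_0 [simp]: "pgf_upto 0 = 1"
  by (simp add: pgf_upto_def)

lemma pgf_upto_step: "pgf_upto k = (1 - q ^ Suc k) * pgf_upto (Suc k)"
proof -
  have "{1..Suc k} - {Suc k} = {1..k}" by auto
  then show ?thesis using pgf_remove[of "{1..Suc k}" "Suc k"] by (simp add: pgf_upto_def)
qed

text \<open>After multiplication by \<open>A\<close> this is summand \<open>w\<close> of the
  generating function of \<open>Mbar k\<close>, with \<open>w\<close> the number of ones.\<close>

definition crank_term :: "nat \<Rightarrow> nat \<Rightarrow> int fps" where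
  "crank_term k w = q ^ (w ^ 2 + (k + 2) * w + k) * pgf_upto w * pgf_upto (k + w)"

text \<open>Here \<open>m = M + 2\<close>, and \<open>diff_rest M w\<close> is the amount moved from summand \<open>w + 1\<close> to summand \<open>w\<close>.
  Any multiple of \<open>T\<^sub>w q^(2 w + m + 2)\<close> may be moved; this one makes \<open>1 - q^(m + w)\<close> split off.\<close>

definition diff_rest :: "nat \<Rightarrow> nat \<Rightarrow> int fps" where
  "diff_rest M w = q ^ (w ^ 2 + (M + 3) * w + M + 1) * pgf_upto w * pgf_upto (M + 2 + w)
     * q ^ (M + 3 + 2 * w) * (q + (1 - q) * q ^ (w + 2 + M))"

text \<open>What summand \<open>w\<close> becomes after receiving \<open>diff_rest M w\<close> from
  summand \<open>w + 1\<close> and, for \<open>w > 0\<close>, giving up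
  \<open>diff_rest M (w - 1)\<close> to summand \<open>w - 1\<close>. The factor
  \<open>1 - q^(m + w)\<close> has been absorbed by passing from \<open>pgf_upto (M + 2 + w)\<close>
  to \<open>pgf_upto (M + 1 + w)\<close>.\<close>

definition diff_main :: "nat \<Rightarrow> nat \<Rightarrow> int fps" where
  "diff_main M w = (1 - q) * q ^ (w ^ 2 + (M + 4) * w + M + 1) * pgf_upto w * pgf_upto (M + 1 + w)
     * ((1 - q ^ M) + q ^ (M + w) * (1 - q ^ 3))"

lemma sum_crank_term_diff:
  "(\<Sum>w\<le>W. crank_term (M + 1) w - crank_term (M + 2) w) = (\<Sum>w\<le>W. diff_main M w) - diff_rest M W"
proof (induction W)
  case 0
  define y P where "y = q ^ M" and "P = pgf_upto (Suc (Suc M))"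
  have p: "pgf_upto (Suc M) = (1 - q * (q * y)) * P"
    using pgf_upto_step[of "M + 1"] by (simp add: P_def y_def)
  have *: "x * y * ((1 - x * (x * y)) * P) - x * (x * y) * P
      = (1 - x) * (x * y) * ((1 - x * (x * y)) * P) * ((1 - y) + y * (1 - x ^ 3))
        - x * y * P * (y * x ^ 3) * (x + (1 - x) * (x * (x * y)))" for x y P :: "int fps"
    by algebra
  show ?case
    using *[of q y P]
    by (simp add: crank_term_def diff_main_def diff_rest_def p power_add flip: y_def P_def)
next
  case (Suc W)
  \<comment> \<open>With letters for the powers of \<open>q\<close>, and the longer products
    \<open>P\<close> and \<open>R\<close> in place of the shorter ones, the step becomes a
    polynomial identity.\<close>
  define c u y P R where "c = q ^ (W ^ 2 + (M + 3) * W + M + 1)" and "u = q ^ W" and "y = q ^ M"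
    and "P = pgf_upto (Suc W)" and "R = pgf_upto (M + 2 + Suc W)"
  note defs = c_def u_def y_def
  have pW: "pgf_upto W = (1 - q * u) * P"
    using pgf_upto_step[of W] by (simp add: P_def u_def)
  have pR: "pgf_upto (M + 2 + W) = (1 - q ^ 3 * y * u) * R"
    "pgf_upto (M + 1 + Suc W) = (1 - q ^ 3 * y * u) * R"
    using pgf_upto_step[of "M + 2 + W"]
    by (simp_all add: R_def u_def y_def power_add mult_ac eval_nat_numeral)
  have e1: "q ^ (Suc W ^ 2 + (M + 1 + 2) * Suc W + (M + 1)) = c * u ^ 2 * y * q ^ 4"
    unfolding defs power_mult[symmetric] power_add[symmetric]
    by (rule arg_cong[of _ _ "(^) q"]) (simp add: power2_eq_square algebra_simps)
  have e2: "q ^ (Suc W ^ 2 + (M + 2 + 2) * Suc W + (M + 2)) = c * u ^ 3 * y * q ^ 6"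
    unfolding defs power_mult[symmetric] power_add[symmetric]
    by (rule arg_cong[of _ _ "(^) q"]) (simp add: power2_eq_square algebra_simps)
  have e3: "q ^ (Suc W ^ 2 + (M + 4) * Suc W + M + 1) = c * u ^ 3 * y * q ^ 5"
    unfolding defs power_mult[symmetric] power_add[symmetric]
    by (rule arg_cong[of _ _ "(^) q"]) (simp add: power2_eq_square algebra_simps)
  have e4: "q ^ (Suc W ^ 2 + (M + 3) * Suc W + M + 1) = c * u ^ 2 * y * q ^ 4"
    unfolding defs power_mult[symmetric] power_add[symmetric]
    by (rule arg_cong[of _ _ "(^) q"]) (simp add: power2_eq_square algebra_simps)
  have e5: "q ^ (M + Suc W) = q * u * y" "q ^ (M + 3 + 2 * Suc W) = q ^ 5 * y * u ^ 2"
    "q ^ (Suc W + 2 + M) = q ^ 3 * u * y" "q ^ (M + 3 + 2 * W) = q ^ 3 * y * u ^ 2"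
    "q ^ (W + 2 + M) = q ^ 2 * u * y"
    by (simp_all add: u_def y_def power_add power_mult eval_nat_numeral power_mult_distrib mult_ac)
  have step: "crank_term (M + 1) (Suc W) - crank_term (M + 2) (Suc W)
      = diff_main M (Suc W) - diff_rest M (Suc W) + diff_rest M W"
    unfolding crank_term_def diff_main_def diff_rest_def
    unfolding e1 e2 e3 e4 e5 pW pR P_def[symmetric] R_def[symmetric] c_def[symmetric] y_def[symmetric]
    by algebra
  show ?case by (simp only: sum.atMost_Suc Suc.IH step) simp
qed

text \<open>The case \<open>m = 1\<close>. Summand \<open>0\<close> needs a larger share, since there only the factors of
  \<open>A\<close> are available.\<close>

definition diff0_rest :: "nat \<Rightarrow> int fps" where
  "diff0_rest w = q ^ (w ^ 2 + 2 * w) * pgf_upto w * pgf_upto (Suc w)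
     * (q ^ (2 * w + 3) + (1 - q) * q ^ (3 * w + 4)
        + (1 - q) * q ^ (4 * w + 5) * (1 - (if w = 0 then q ^ 4 else q ^ 2)))"

text \<open>The shifted summands for \<open>m = 1\<close>. The exponent 4 in
  \<open>diff0_rest 0\<close>, instead of 2, makes \<open>1 - q^3\<close> divide summand 0. It
  affects summands 0 and 1 only, hence the three formulas.\<close>

definition diff0_main :: "nat \<Rightarrow> int fps" where
  "diff0_main w =
     (if w = 0 then (1 - q ^ 3) * ((1 - q) * (1 - q ^ 2) + q ^ 6)
      else if w = 1 then q ^ 5 * pgf_upto 2 * ((1 - q) * (1 - q ^ 2) * (q - q ^ 6) + (1 - q) * q ^ 7)
      else (1 - q) * q ^ (w ^ 2 + 5 * w) * pgf_upto w * pgf_upto (Suc w)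
        * ((1 - q ^ 2) * (1 - q ^ 3) * (1 - q ^ Suc w) + q ^ 4 * (1 - q) * (1 - q ^ w)
           + q ^ (w + 6) * (1 - q)))"

lemma sum_crank_term_diff0:
  "(\<Sum>w\<le>W. crank_term 0 w - crank_term 1 w) = (\<Sum>w\<le>W. diff0_main w) - diff0_rest W"
proof (induction W)
  case 0
  define P where "P = pgf_upto (Suc 0)"
  have "(1 - q) * P = 1" using pgf_upto_step[of 0] by (simp add: P_def)
  then have "1 - q * P = (1 - q ^ 3) * ((1 - q) * (1 - q ^ 2) + q ^ 6)
      - P * (q ^ 3 + (1 - q) * q ^ 4 + (1 - q) * q ^ 5 * (1 - q ^ 4))"
    by algebra
  then show ?case
    by (simp add: crank_term_def diff0_main_def diff0_rest_def P_def)
next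
  case (Suc W)
  define c u P R where "c = q ^ (W ^ 2 + 2 * W)" and "u = q ^ W"
    and "P = pgf_upto (Suc W)" and "R = pgf_upto (Suc (Suc W))"
  have pW: "pgf_upto W = (1 - q * u) * P"
    using pgf_upto_step[of W] by (simp add: P_def u_def)
  have pR: "P = (1 - q ^ 2 * u) * R"
    using pgf_upto_step[of "Suc W"] by (simp add: P_def R_def u_def power2_eq_square mult_ac)
  have e: "q ^ (Suc W ^ 2 + (0 + 2) * Suc W + 0) = c * u ^ 2 * q ^ 3"
    "q ^ (Suc W ^ 2 + (1 + 2) * Suc W + 1) = c * u ^ 3 * q ^ 5"
    "q ^ (Suc W ^ 2 + 2 * Suc W) = c * u ^ 2 * q ^ 3"
    "q ^ (Suc W ^ 2 + 5 * Suc W) = c * u ^ 5 * q ^ 6"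
    unfolding c_def u_def power_mult[symmetric] power_add[symmetric]
    by (rule arg_cong[of _ _ "(^) q"], simp add: power2_eq_square algebra_simps)+
  have e': "q ^ (2 * W + 3) = u ^ 2 * q ^ 3" "q ^ (3 * W + 4) = u ^ 3 * q ^ 4"
    "q ^ (4 * W + 5) = u ^ 4 * q ^ 5" "q ^ (2 * Suc W + 3) = u ^ 2 * q ^ 5"
    "q ^ (3 * Suc W + 4) = u ^ 3 * q ^ 7" "q ^ (4 * Suc W + 5) = u ^ 4 * q ^ 9"
    "q ^ (Suc W + 6) = u * q ^ 7" "q ^ Suc (Suc W) = u * q ^ 2" "q ^ Suc W = u * q ^ 1"
    unfolding u_def power_mult[symmetric] power_add[symmetric]
    by (rule arg_cong[of _ _ "(^) q"], simp)+
  have s: "pgf_upto (0 + Suc W) = P" "pgf_upto (1 + Suc W) = R" "pgf_upto (Suc (Suc W)) = R"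
    "pgf_upto (Suc W) = P" by (simp_all add: P_def R_def)
  have step: "crank_term 0 (Suc W) - crank_term 1 (Suc W)
      = diff0_main (Suc W) - diff0_rest (Suc W) + diff0_rest W"
  \<comment> \<open>\<open>W = 0\<close> is separate because \<open>diff0_rest 0\<close> and
    \<open>diff0_main 1\<close> have formulas of their own. Its identity also uses that
    \<open>P\<close> is \<open>1 / (1 - q)\<close>.\<close>
  proof (cases "W = 0")
    case True
    have cu: "c = 1" "u = 1" using True by (simp_all add: c_def u_def)
    have P1: "(1 - q) * P = 1" using pW True cu by simp
    have m: "diff0_main (Suc W) = q ^ 5 * R * ((1 - q) * (1 - q ^ 2) * (q - q ^ 6) + (1 - q) * q ^ 7)"
      using True by (simp add: diff0_main_def R_def numeral_2_eq_2)
    have i: "(if W = 0 then a else b) = a" "(if Suc W = 0 then a else b) = b" for a b :: "int fps"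
      using True by auto
    have "q ^ 3 * P * P - q ^ 5 * P * R
      = q ^ 5 * R * ((1 - q) * (1 - q ^ 2) * (q - q ^ 6) + (1 - q) * q ^ 7)
        - q ^ 3 * P * R * (q ^ 5 + (1 - q) * q ^ 7 + (1 - q) * q ^ 9 * (1 - q ^ 2))
        + (1 - q) * P * P * (q ^ 3 + (1 - q) * q ^ 4 + (1 - q) * q ^ 5 * (1 - q ^ 4))"
      using P1 pR[unfolded cu] by algebra
    then show ?thesis
      unfolding crank_term_def diff0_rest_def m i e e' s pW c_def[symmetric] cu by simp
  next
    case False
    then have i: "(if W = 0 then a else b) = b" "(if Suc W = 1 then a else b) = b"
      "(if Suc W = 0 then a else b) = b" for a b :: "int fps" by auto
    show ?thesis
      unfolding crank_term_def diff0_main_def diff0_rest_def i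
      unfolding e e' s pW c_def[symmetric] unfolding pR
      by algebra
  qed
  show ?case by (simp only: sum.atMost_Suc Suc.IH step) simp
qed

section \<open>Nonnegativity of the shifted summands\<close>

lemma nonneg_pgf_upto: "nonneg (pgf_upto k)"
  by (simp add: pgf_upto_def nonneg_pgf)

lemma nonneg_pgf_upto_remove: "1 \<le> j \<Longrightarrow> j \<le> k \<Longrightarrow> nonneg ((1 - q ^ j) * pgf_upto k)"
  by (simp add: pgf_upto_def nonneg_pgf_remove)

lemma nonneg_pgf_upto_remove1: "1 \<le> k \<Longrightarrow> nonneg ((1 - q) * pgf_upto k)"
  using nonneg_pgf_upto_remove[of 1 k] by simp

lemma nonneg_pgf_upto_remove2:
  "1 < j \<Longrightarrow> j \<le> k \<Longrightarrow> nonneg ((1 - q) * ((1 - q ^ j) * pgf_upto k))"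
  using nonneg_pgf_remove2[of "{1..k}" 1 j] by (simp add: pgf_upto_def)

lemma nonneg_odd_remove: "odd j \<Longrightarrow> 3 \<le> j \<Longrightarrow> nonneg ((1 - q ^ j) * pgf (odd_from 3))"
  by (simp add: nonneg_pgf_remove)

lemmas nonneg_removes =
  nonneg_pgf_upto_remove nonneg_pgf_upto_remove1 nonneg_pgf_upto_remove2 nonneg_odd_remove

lemmas nonneg_intros = nonneg_add nonneg_mult nonneg_X_power nonneg_pgf nonneg_pgf_upto

text \<open>For \<open>w > 0\<close> each factor with negative coefficients has its own series to
  cancel against: \<open>1 - q^3\<close> goes to \<open>A\<close>, \<open>1 - q\<close> to
  \<open>pgf_upto w\<close> and \<open>1 - q^M\<close> to \<open>pgf_upto (M + 1 + w)\<close>. For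
  \<open>w = 0\<close>, \<open>pgf_upto 0 = 1\<close> cannot take \<open>1 - q\<close>, which must
  then go to \<open>pgf_upto (M + 1)\<close> as well.\<close>

lemma nonneg_diff_main: "nonneg (pgf (odd_from 3) * diff_main M w)"
proof (cases "w = 0")
  case False
  have M: "nonneg ((1 - q ^ M) * pgf_upto (M + 1 + w))"
  proof (cases "M = 0")
    case True
    then show ?thesis by (simp add: nonneg_def)
  next
    case False
    then show ?thesis by (intro nonneg_pgf_upto_remove) auto
  qed
  define e where "e = w ^ 2 + (M + 4) * w + M + 1"
  have "pgf (odd_from 3) * diff_main M w = q ^ e *
     (pgf (odd_from 3) * ((1 - q) * pgf_upto w) * ((1 - q ^ M) * pgf_upto (M + 1 + w))
      + q ^ (M + w) * ((1 - q ^ 3) * pgf (odd_from 3)) * ((1 - q) * pgf_upto w) * pgf_upto (M + 1 + w))"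
    unfolding diff_main_def e_def[symmetric] by algebra
  moreover have "nonneg \<dots>" by (insert False M) ((assumption | (rule nonneg_removes; simp; fail) | rule nonneg_intros)+)
  ultimately show ?thesis by (simp only:)
next
  case True
  define p where "p = pgf_upto (M + 1)"
  have d: "diff_main M w = (1 - q) * q ^ (M + 1) * p * ((1 - q ^ M) + q ^ M * (1 - q ^ 3))"
    using True by (simp add: diff_main_def p_def)
  \<comment> \<open>For \<open>M \<ge> 2\<close>, \<open>1 - q\<close> and \<open>1 - q^M\<close>
    are different factors of the denominator of \<open>pgf_upto (M + 1)\<close> and cancel together;
    for \<open>M = 0\<close> the latter vanishes.\<close>
  consider "M = 0" | "M = 1" | "M \<ge> 2" by linarith
  then show ?thesis
  proof cases
    case 1
    have "pgf (odd_from 3) * diff_main M w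
        = q ^ (M + 1) * ((1 - q ^ 3) * pgf (odd_from 3)) * ((1 - q) * p)"
      unfolding d unfolding 1 by (simp add: mult_ac)
    moreover have "nonneg \<dots>" unfolding p_def by ((assumption | (rule nonneg_removes; simp; fail) | rule nonneg_intros)+)
    ultimately show ?thesis by (simp only:)
  next
    case 2
    \<comment> \<open>Here the bracket is
      \<open>(1 - q) + q * (1 - q^3) = 1 - q^4 = (1 - q^2) * (1 + q^2)\<close>.\<close>
    have "pgf (odd_from 3) * diff_main M w
        = q ^ (M + 1) * pgf (odd_from 3) * ((1 - q) * ((1 - q ^ 2) * p)) * (q ^ 0 + q ^ 2)"
      unfolding d unfolding 2 by (simp add: eval_nat_numeral algebra_simps)
    moreover have "nonneg \<dots>" unfolding p_def by (insert 2) ((assumption | (rule nonneg_removes; simp; fail) | rule nonneg_intros)+)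
    ultimately show ?thesis by (simp only:)
  next
    case 3
    have "pgf (odd_from 3) * diff_main M w
        = q ^ (M + 1) * (pgf (odd_from 3) * ((1 - q) * ((1 - q ^ M) * p))
          + q ^ M * ((1 - q ^ 3) * pgf (odd_from 3)) * ((1 - q) * p))"
      unfolding d by algebra
    moreover have "nonneg \<dots>" unfolding p_def by (insert 3) ((assumption | (rule nonneg_removes; simp; fail) | rule nonneg_intros)+)
    ultimately show ?thesis by (simp only:)
  qed
qed

lemma nth_X_power_mult_eq_0: "n < e \<Longrightarrow> fps_nth (q ^ e * f) n = 0"
  by (simp add: fps_X_power_mult_nth)

text \<open>\<open>diff_rest M n\<close> starts beyond \<open>q^n\<close>, so cutting the sum at
  \<open>w = n\<close> leaves only the nonnegative \<open>diff_main M w\<close> in coefficient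
  \<open>n\<close>.\<close>

lemma crank_term_diff_nonneg:
  "fps_nth (pgf (odd_from 3) * (\<Sum>w\<le>n. crank_term (M + 1) w - crank_term (M + 2) w)) n \<ge> 0"
proof -
  have "pgf (odd_from 3) * diff_rest M n = q ^ (n ^ 2 + (M + 3) * n + M + 1) *
      (pgf (odd_from 3) * (pgf_upto n * pgf_upto (M + 2 + n)
        * q ^ (M + 3 + 2 * n) * (q + (1 - q) * q ^ (n + 2 + M))))"
    by (simp only: diff_rest_def mult_ac)
  then have "fps_nth (pgf (odd_from 3) * diff_rest M n) n = 0"
    by (simp only:) (intro nth_X_power_mult_eq_0, simp add: algebra_simps)
  moreover have "nonneg (\<Sum>w\<le>n. pgf (odd_from 3) * diff_main M w)"
    by (intro nonneg_sum nonneg_diff_main)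
  ultimately show ?thesis
    unfolding sum_crank_term_diff by (simp add: right_diff_distrib sum_distrib_left nonneg_def)
qed

text \<open>The factor \<open>q ^ 5\<close> keeps these summands away from the coefficients 1 and 2.
  For \<open>w \<ge> 2\<close>, \<open>1 - q^(w + 1)\<close> turns \<open>pgf_upto (Suc w)\<close>
  into \<open>pgf_upto w\<close>, which then absorbs \<open>1 - q^2\<close>; in the middle term
  \<open>1 - q\<close> and \<open>1 - q^w\<close> are different factors and cancel together.\<close>

lemma diff0_main_pos:
  assumes "w \<ge> 1"
  obtains g where "nonneg g" "pgf (odd_from 3) * diff0_main w = q ^ 5 * g"
proof (cases "w = 1")
  case True
  let ?g = "q ^ 1 * ((1 - q ^ 5) * pgf (odd_from 3)) * ((1 - q) * ((1 - q ^ 2) * pgf_upto 2))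
      + q ^ 7 * pgf (odd_from 3) * ((1 - q) * pgf_upto 2)"
  have d: "diff0_main w
      = q ^ 5 * pgf_upto 2 * ((1 - q) * (1 - q ^ 2) * (q - q ^ 6) + (1 - q) * q ^ 7)"
    using True by (simp add: diff0_main_def)
  have "pgf (odd_from 3) * diff0_main w = q ^ 5 * ?g"
    unfolding d by algebra
  moreover have "nonneg ?g"
    by ((assumption | (rule nonneg_removes; simp; fail) | rule nonneg_intros)+)
  ultimately show ?thesis by (rule that[rotated])
next
  case False
  with assms have w: "w \<ge> 2" by simp
  define e where "e = w ^ 2 + 5 * w - 5"
  have e: "w ^ 2 + 5 * w = 5 + e" using w by (simp add: e_def)
  let ?A = "pgf (odd_from 3)"
  let ?g = "q ^ e * ((1 - q) * pgf_upto w) *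
      (((1 - q ^ 3) * ?A) * ((1 - q ^ 2) * pgf_upto w)
       + q ^ 4 * ?A * ((1 - q) * ((1 - q ^ w) * pgf_upto (Suc w)))
       + q ^ (w + 6) * ?A * ((1 - q) * pgf_upto (Suc w)))"
  have d: "diff0_main w = (1 - q) * (q ^ 5 * q ^ e) * pgf_upto w * pgf_upto (Suc w)
        * ((1 - q ^ 2) * (1 - q ^ 3) * (1 - q ^ Suc w) + q ^ 4 * (1 - q) * (1 - q ^ w)
           + q ^ (w + 6) * (1 - q))"
    using w by (simp add: diff0_main_def e power_add)
  have "A * ((1 - x) * (x ^ 5 * e) * P * R
        * ((1 - x ^ 2) * (1 - x ^ 3) * s + x ^ 4 * (1 - x) * t + v * (1 - x)))
      = x ^ 5 * (e * ((1 - x) * P) * (((1 - x ^ 3) * A) * ((1 - x ^ 2) * P)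
        + x ^ 4 * A * ((1 - x) * (t * R)) + v * A * ((1 - x) * R)))"
    if "P = s * R" for x e P R s t v A :: "int fps"
    using that by algebra
  from this[OF pgf_upto_step[of w]]
  have "pgf (odd_from 3) * diff0_main w = q ^ 5 * ?g"
    unfolding d .
  moreover have "nonneg ?g"
    by (insert w) ((assumption | (rule nonneg_removes; simp; fail) | rule nonneg_intros)+)
  ultimately show ?thesis by (rule that[rotated])
qed

text \<open>Only summand 0 contributes at 1 and 2, where it is negative; at every other
  \<open>n\<close> all summands are nonnegative.\<close>

lemma crank_term_diff0_nonneg_iff:
  "fps_nth (pgf (odd_from 3) * (\<Sum>w\<le>n. crank_term 0 w - crank_term 1 w)) n \<ge> 0 \<longleftrightarrow> n \<notin> {1, 2}"
proof -
  let ?A = "pgf (odd_from 3)"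
  define h where "h = ?A * diff0_main 0"
  have "h = pgf (odd_from 5) * ((1 - q) * (1 - q ^ 2) + q ^ 6)"
    unfolding h_def diff0_main_def pgf_odd_from_3[symmetric] by (simp add: mult_ac)
  then have h: "n \<notin> {1, 2} \<Longrightarrow> fps_nth h n \<ge> 0" "n \<in> {1, 2} \<Longrightarrow> fps_nth h n < 0"
    using pgf_odd_from_5_second_difference[of n] by simp_all
  have "fps_nth (?A * diff0_rest n) n = 0"
  proof -
    \<comment> \<open>For \<open>n = 0\<close> the leading power of \<open>q\<close> in
      \<open>diff0_rest n\<close> is 1, so the factor \<open>q ^ (n + 1)\<close> is taken out of the
      bracket.\<close>
    have "q ^ (2 * n + 3) = q ^ (n + 1) * q ^ (n + 2)" "q ^ (3 * n + 4) = q ^ (n + 1) * q ^ (2 * n + 3)"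
      "q ^ (4 * n + 5) = q ^ (n + 1) * q ^ (3 * n + 4)"
      by (simp_all flip: power_add power_Suc)
    then have "\<exists>g. ?A * diff0_rest n = q ^ (n + 1) * g"
      unfolding diff0_rest_def
      by (intro exI[of _ "?A * (q ^ (n ^ 2 + 2 * n) * pgf_upto n * pgf_upto (Suc n)
        * (q ^ (n + 2) + (1 - q) * q ^ (2 * n + 3)
        + (1 - q) * q ^ (3 * n + 4) * (1 - (if n = 0 then q ^ 4 else q ^ 2))))"])
        (simp only: distrib_left distrib_right mult_ac)
    then obtain g where "?A * diff0_rest n = q ^ (n + 1) * g" by blast
    then show ?thesis using nth_X_power_mult_eq_0[of n "n + 1" g] by simp
  qed
  moreover have "?A * (\<Sum>w\<le>n. diff0_main w) = h + (\<Sum>w\<in>{1..n}. ?A * diff0_main w)"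
  proof -
    have "{..n} = insert 0 {1..n}" by auto
    then show ?thesis by (simp add: h_def sum_distrib_left distrib_left)
  qed
  ultimately have eq: "fps_nth (?A * (\<Sum>w\<le>n. crank_term 0 w - crank_term 1 w)) n
      = fps_nth h n + (\<Sum>w\<in>{1..n}. fps_nth (?A * diff0_main w) n)"
    unfolding sum_crank_term_diff0 right_diff_distrib by (simp add: fps_sum_nth)
  have nn: "fps_nth (?A * diff0_main w) n \<ge> 0" if w: "w \<in> {1..n}" for w
  proof -
    obtain g where "nonneg g" "?A * diff0_main w = q ^ 5 * g"
      using diff0_main_pos[of w] w by auto
    then show ?thesis by (simp add: fps_X_power_mult_nth nonneg_def)
  qed
  show ?thesis
  proof (cases "n \<in> {1, 2}")
    case True
    have "fps_nth (?A * diff0_main w) n = 0" if w: "w \<in> {1..n}" for w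
    proof -
      obtain g where "?A * diff0_main w = q ^ 5 * g"
        using diff0_main_pos[of w] w by auto
      then show ?thesis using True by (auto simp: nth_X_power_mult_eq_0)
    qed
    then have "(\<Sum>w\<in>{1..n}. fps_nth (?A * diff0_main w) n) = 0" by (rule sum.neutral[rule_format])
    with True h(2) show ?thesis unfolding eq by simp
  next
    case False
    have "(\<Sum>w\<in>{1..n}. fps_nth (?A * diff0_main w) n) \<ge> 0" using nn by (rule sum_nonneg)
    with h(1)[OF False] False show ?thesis unfolding eq by simp
  qed
qed

section \<open>Residual cranks\<close>

text \<open>Splitting off one copy of each overlined size makes an overpartition an independent pair
  of its non-overlined partition and a finite set of positive sizes. The predicate is arbitrary
  because \<open>Mbar\<close> counts two different classes.\<close>

lemma card_overpartitions_nonoverlined: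
  "int (card {\<pi> \<in> overpartitions n. \<Phi> (nonoverlined \<pi>)})
    = fps_nth (gf {P \<in> parts_in {0<..}. \<Phi> P} sum_mset * distinct_gf) n"
proof -
  let ?X = "{P \<in> parts_in {0<..}. \<Phi> P}" and ?D = "{S. finite S \<and> (0::nat) \<notin> S}"
  let ?Z = "{z \<in> ?X \<times> ?D. sum_mset (fst z) + \<Sum>(snd z) = n}"
  let ?f = "\<lambda>(R, S). (R + mset_set S, S)" and ?g = "\<lambda>(P, S). (P - mset_set S, S)"
  have "bij_betw ?f ?Z {\<pi> \<in> overpartitions n. \<Phi> (nonoverlined \<pi>)}"
  proof (rule bij_betwI[where g = ?g])
    show "?f \<in> ?Z \<rightarrow> {\<pi> \<in> overpartitions n. \<Phi> (nonoverlined \<pi>)}"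
      by (auto simp: overpartitions_def partitions_def nonoverlined_def parts_in_def
          sum_unfold_sum_mset)
    have sub: "mset_set S \<subseteq># P" if "S \<subseteq> set_mset P" for S and P :: "nat multiset"
      unfolding subseteq_mset_def
    proof
      fix a
      have "a \<in> S \<Longrightarrow> 1 \<le> count P a" using that by (auto simp: Suc_le_eq)
      then show "count (mset_set S) a \<le> count P a" by (auto simp: count_mset_set')
    qed
    show "?f (?g z) = z" if "z \<in> {\<pi> \<in> overpartitions n. \<Phi> (nonoverlined \<pi>)}" for z
      using that sub by (auto simp: overpartitions_def)
    show "?g \<in> {\<pi> \<in> overpartitions n. \<Phi> (nonoverlined \<pi>)} \<rightarrow> ?Z"
    proof
      fix z assume z: "z \<in> {\<pi> \<in> overpartitions n. \<Phi> (nonoverlined \<pi>)}"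
      obtain P S where PS: "z = (P, S)" by fastforce
      have S: "S \<subseteq> set_mset P" "0 \<notin># P" "sum_mset P = n" "\<Phi> (P - mset_set S)"
        using z PS by (auto simp: overpartitions_def partitions_def nonoverlined_def)
      have "sum_mset (P - mset_set S) + \<Sum>S = sum_mset (P - mset_set S + mset_set S)"
        by (simp add: sum_unfold_sum_mset)
      also have "\<dots> = n" using sub[OF S(1)] S(3) by simp
      finally have "sum_mset (P - mset_set S) + \<Sum>S = n" .
      moreover have "finite S" using S(1) by (rule finite_subset) simp
      moreover have "P - mset_set S \<in> parts_in {0<..}"
        using S(2) by (auto simp: parts_in_def intro!: gr0I dest: in_diffD)
      ultimately show "?g z \<in> ?Z" using S by (auto simp: PS)
    qed
    show "?g (?f z) = z" if "z \<in> ?Z" for z by (cases z) simp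
  qed
  then have "card {\<pi> \<in> overpartitions n. \<Phi> (nonoverlined \<pi>)} = card ?Z"
    by (rule bij_betw_same_card[symmetric])
  moreover have "fin_levels ?X sum_mset"
    by (rule fin_levels_subset[OF fin_levels_parts[of "{0<..}"]]) auto
  ultimately show ?thesis
    unfolding distinct_gf_def by (simp add: gf_Times[symmetric] fin_levels_distinct gf_nth)
qed

section \<open>Partitions with given crank and number of ones\<close>

definition crank_class :: "nat \<Rightarrow> nat \<Rightarrow> nat multiset set" where
  "crank_class k w = {P \<in> parts_in {0<..}. P \<noteq> {#1#} \<and> crank P = int k \<and> count P 1 = w}"

lemma pgf_from_2: "k \<ge> 1 \<Longrightarrow> pgf {2..k} = (1 - q) * pgf_upto k"
proof -
  assume "k \<ge> 1"
  moreover have "{1..k} - {1} = {2..k}" by auto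
  ultimately show ?thesis using pgf_remove[of "{1..k}" 1] by (simp add: pgf_upto_def)
qed

text \<open>Such a partition consists of \<open>w\<close> ones, parts from 2 to \<open>w\<close>,
  and exactly \<open>k + w\<close> parts greater than \<open>w\<close>. These contribute
  \<open>q ^ w\<close>, \<open>pgf {2..w}\<close> and the series of
  \<open>gf_size_gt\<close>.\<close>

lemma gf_crank_class_pos:
  assumes "w \<ge> 1"
  shows "gf (crank_class k w) sum_mset = (1 - q) * crank_term k w"
proof -
  let ?Y = "{P. size P = k + w \<and> (\<forall>x\<in>#P. w < x)}"
  let ?Z = "{P \<in> parts_in {0<..}. count P 1 = w \<and> size (filter_mset (\<lambda>x. w < x) P) = k + w}"
  let ?f = "\<lambda>(R, T). R + replicate_mset w 1 + T"
  let ?g = "\<lambda>P. (filter_mset (\<lambda>x. 2 \<le> x \<and> x \<le> w) P, filter_mset (\<lambda>x. w < x) P)"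
  have cls: "crank_class k w = ?Z"
  proof -
    have "P \<noteq> {#1#} \<and> crank P = int k \<and> count P 1 = w
      \<longleftrightarrow> count P 1 = w \<and> size (filter_mset (\<lambda>x. w < x) P) = k + w" for P
    proof (cases "count P 1 = w")
      case True
      then have "1 \<in># P" using assms by (metis count_eq_zero_iff not_one_le_zero)
      then have "crank P = int (size (filter_mset (\<lambda>x. w < x) P)) - int w"
        using True by (simp add: crank_def)
      then show ?thesis using True assms by auto
    qed auto
    then show ?thesis by (auto simp: crank_class_def)
  qed
  have "bij_betw ?f (parts_in {2..w} \<times> ?Y) ?Z"
  proof (rule bij_betwI[where g = ?g])
    fix z assume "z \<in> parts_in {2..w} \<times> ?Y"
    then obtain R T where z: "z = (R, T)" "set_mset R \<subseteq> {2..w}" "size T = k + w" "\<forall>x\<in>#T. w < x"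
      by (auto simp: parts_in_def)
    have 1: "filter_mset (\<lambda>x. 2 \<le> x \<and> x \<le> w) R = R" "filter_mset (\<lambda>x. w < x) T = T"
      using z by (auto simp: filter_mset_eq_conv)
    have 2: "filter_mset (\<lambda>x. 2 \<le> x \<and> x \<le> w) T = {#}" "filter_mset (\<lambda>x. w < x) R = {#}"
      using z by auto
    have 3: "filter_mset (\<lambda>x. 2 \<le> x \<and> x \<le> w) (replicate_mset w (1::nat)) = {#}"
      "filter_mset (\<lambda>x. w < x) (replicate_mset w (1::nat)) = {#}"
      using assms by auto
    show "?g (?f z) = z" by (simp add: z(1) 1 2 3)
  next
    fix P assume P: "P \<in> ?Z"
    show "?f (?g P) = P"
    proof (rule multiset_eqI)
      fix x
      have "count P 0 = 0" using P by (auto simp: parts_in_def count_eq_zero_iff)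
      then show "count (?f (?g P)) x = count P x"
        using P assms by (cases "x = 0"; cases "x = 1") auto
    qed
  next
    show "?g \<in> ?Z \<rightarrow> parts_in {2..w} \<times> ?Y" by (auto simp: parts_in_def)
    show "?f \<in> parts_in {2..w} \<times> ?Y \<rightarrow> ?Z"
    proof
      fix z assume "z \<in> parts_in {2..w} \<times> ?Y"
      then obtain R T where z: "z = (R, T)" "set_mset R \<subseteq> {2..w}" "size T = k + w" "\<forall>x\<in>#T. w < x"
        by (auto simp: parts_in_def)
      have "filter_mset (\<lambda>x. w < x) T = T" "filter_mset (\<lambda>x. w < x) R = {#}"
        "filter_mset (\<lambda>x. w < x) (replicate_mset w (1::nat)) = {#}"
        using z assms by (auto simp: filter_mset_eq_conv)
      moreover have "count R 1 = 0" "count T 1 = 0"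
        using z assms by (auto simp: count_eq_zero_iff)
      moreover have "R + replicate_mset w 1 + T \<in> parts_in {0<..}"
        using z by (auto simp: parts_in_def subset_iff)
      ultimately show "?f z \<in> ?Z" using z(1,3) by simp
    qed
  qed
  then have "gf ?Z sum_mset
      = q ^ w * gf (parts_in {2..w} \<times> ?Y) (\<lambda>z. sum_mset (fst z) + sum_mset (snd z))"
    by (rule gf_bij) auto
  also have "gf (parts_in {2..w} \<times> ?Y) (\<lambda>z. sum_mset (fst z) + sum_mset (snd z))
      = pgf {2..w} * (q ^ (Suc w * (k + w)) * pgf_upto (k + w))"
  proof -
    have "fin_levels ?Y sum_mset" unfolding fin_levels_def
      by (auto intro: finite_subset[OF _ finite_size_sum[of "k + w"]])
    then show ?thesis
      unfolding pgf_def[of "{2..w}"] pgf_upto_def gf_size_gt[symmetric]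
      by (intro gf_Times fin_levels_parts) auto
  qed
  also have "q ^ w * (pgf {2..w} * (q ^ (Suc w * (k + w)) * pgf_upto (k + w)))
      = (1 - q) * (q ^ w * q ^ (Suc w * (k + w)) * pgf_upto w * pgf_upto (k + w))"
    unfolding pgf_from_2[OF assms] by (simp only: mult_ac)
  also have "q ^ w * q ^ (Suc w * (k + w)) = q ^ (w ^ 2 + (k + 2) * w + k)"
    unfolding power_add[symmetric]
    by (rule arg_cong[of _ _ "(^) q"]) (simp add: power2_eq_square algebra_simps)
  finally show ?thesis unfolding cls crank_term_def .
qed

text \<open>The extra multiple of \<open>q\<close> is the modified weight of the partition \<open>{#1#}\<close>.\<close>

lemma gf_crank_class_0:
  "gf (crank_class k 0) sum_mset + of_int (if k = 0 then - 1 else if k = 1 then 1 else 0) * q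
    = (1 - q) * crank_term k 0"
proof -
  have ct: "crank_term k 0 = q ^ k * pgf_upto k" by (simp add: crank_term_def)
  have cls: "crank_class k 0
      = {P \<in> parts_in {0<..}. 1 \<notin># P \<and> (if P = {#} then k = 0 else Max (set_mset P) = k)}"
    by (auto simp: crank_class_def crank_def count_eq_zero_iff split: if_splits)
  have Max: "Max (set_mset P) \<in># P" if "P \<noteq> {#}" for P :: "nat multiset"
    using that by (intro Max_in) auto
  \<comment> \<open>For \<open>k = 0\<close> the class holds just the empty partition; for
    \<open>k = 1\<close> it is empty and the correction supplies all of \<open>q\<close>; from 2 on
    there is no correction, and the largest part \<open>k\<close> is deleted.\<close>
  consider "k = 0" | "k = 1" | "k \<ge> 2" by linarith
  then show ?thesis
  proof cases
    case 1
    have "P = {#}" if "P \<in> crank_class k 0" for P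
    proof (rule ccontr)
      assume P: "P \<noteq> {#}"
      then have "Max (set_mset P) \<in> {0<..}"
        using Max[OF P] that[unfolded cls] unfolding parts_in_def by blast
      with P that[unfolded cls] 1 show False by simp
    qed
    moreover have "{#} \<in> crank_class k 0" unfolding cls using 1 by (simp add: parts_in_def)
    ultimately have "crank_class k 0 = parts_in {}" by (auto simp: parts_in_def)
    then have "gf (crank_class k 0) sum_mset = 1" using pgf_empty by (simp add: pgf_def)
    then show ?thesis using 1 ct by simp
  next
    case 2
    have "P \<notin> crank_class k 0" for P
    proof
      assume P: "P \<in> crank_class k 0"
      show False
      proof (cases "P = {#}")
        case True
        with P[unfolded cls] 2 show False by simp
      next
        case False
        then have "Max (set_mset P) = 1" "1 \<notin># P" using P[unfolded cls] 2 by auto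
        with Max[OF False] show False by metis
      qed
    qed
    then have "crank_class k 0 = {}" by blast
    then have "gf (crank_class k 0) sum_mset = 0" by (simp add: gf_def fps_eq_iff)
    moreover have "(1 - q) * pgf_upto 1 = 1" using pgf_upto_step[of 0] by simp
    ultimately show ?thesis using 2 ct by (simp add: mult_ac)
  next
    case 3
    have "bij_betw (add_mset k) (parts_in {2..k}) (crank_class k 0)"
    proof (rule bij_betwI[where g = "\<lambda>P. P - {#k#}"])
      show "add_mset k \<in> parts_in {2..k} \<rightarrow> crank_class k 0"
      proof
        fix R assume R: "R \<in> parts_in {2..k}"
        then have "Max (set_mset (add_mset k R)) = k"
          by (intro Max_eqI) (auto simp: parts_in_def)
        with R 3 show "add_mset k R \<in> crank_class k 0"
          by (auto simp: cls parts_in_def)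
      qed
      have in_class: "k \<in># P \<and> (\<forall>x\<in>#P. 2 \<le> x \<and> x \<le> k)" if "P \<in> crank_class k 0" for P
      proof -
        have P: "P \<noteq> {#}" "Max (set_mset P) = k" "1 \<notin># P" "set_mset P \<subseteq> {0<..}"
          using that 3 by (auto simp: cls parts_in_def split: if_splits)
        have "2 \<le> x \<and> x \<le> k" if "x \<in># P" for x
        proof -
          have "x \<noteq> 0" "x \<noteq> 1" using that P by auto
          moreover have "x \<le> k" using that P(2) by (metis Max_ge finite_set_mset)
          ultimately show ?thesis by linarith
        qed
        then show ?thesis using Max[OF P(1)] P(2) by simp
      qed
      show "(\<lambda>P. P - {#k#}) \<in> crank_class k 0 \<rightarrow> parts_in {2..k}"
        using in_class by (auto simp: parts_in_def dest!: in_diffD)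
      show "add_mset k (P - {#k#}) = P" if "P \<in> crank_class k 0" for P
        using in_class[OF that] by simp
    qed simp
    then have "gf (crank_class k 0) sum_mset = q ^ k * gf (parts_in {2..k}) sum_mset"
      by (rule gf_bij) simp
    also have "\<dots> = q ^ k * ((1 - q) * pgf_upto k)"
      using pgf_from_2[of k] 3 by (simp add: pgf_def)
    finally show ?thesis using 3 ct by (simp add: mult_ac)
  qed
qed

text \<open>The factor \<open>1 - q\<close> carried by every crank class removes 1 from the odd part
  sizes of Euler's theorem, which leaves \<open>A\<close>.\<close>

lemma distinct_gf_remove_1: "(1 - q) * distinct_gf = pgf (odd_from 3)"
proof -
  have "odd j \<and> j \<noteq> 1 \<longleftrightarrow> odd j \<and> 3 \<le> j" for j :: nat by presburger
  then have "{k. odd k} - {1} = odd_from 3" by (auto simp: odd_from_def)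
  then show ?thesis using pgf_remove[of "{k. odd k}" 1] by (simp add: euler_distinct_odd)
qed

lemma fps_mult_nth_cong:
  assumes "\<And>i. i \<le> n \<Longrightarrow> fps_nth f i = fps_nth g i"
  shows "fps_nth (f * h) n = fps_nth (g * h) n"
  using assms by (simp add: fps_mult_nth)

text \<open>A partition of \<open>i \<le> n\<close> has at most \<open>n\<close> ones, so classes
  with \<open>w > n\<close> do not reach coefficient \<open>n\<close> and a finite sum
  suffices.\<close>

lemma Mbar_eq: "Mbar (int k) n = fps_nth (pgf (odd_from 3) * (\<Sum>w\<le>n. crank_term k w)) n"
proof -
  define c :: int where "c = (if k = 0 then - 1 else if k = 1 then 1 else 0)"
  let ?X = "{P \<in> parts_in {0<..}. P \<noteq> {#1#} \<and> crank P = int k}"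
  have count_le: "count P 1 \<le> sum_mset P" for P :: "nat multiset" by (induction P) auto
  have sub: "crank_class k w \<subseteq> parts_in {0<..}" for w by (auto simp: crank_class_def)
  have "fps_nth (gf ?X sum_mset) i = fps_nth (\<Sum>w\<le>n. gf (crank_class k w) sum_mset) i"
    if "i \<le> n" for i
  proof -
    have "(\<Sum>w\<le>n. gf (crank_class k w) sum_mset) = gf (\<Union>w\<le>n. crank_class k w) sum_mset"
      by (rule gf_UN[symmetric])
        (auto intro!: fin_levels_subset[OF fin_levels_parts sub], auto simp: crank_class_def)
    moreover have "{P \<in> ?X. sum_mset P = i} = {P \<in> \<Union>w\<le>n. crank_class k w. sum_mset P = i}"
      using that by (auto simp: crank_class_def intro: order_trans[OF count_le[unfolded One_nat_def]])
    ultimately show ?thesis by (simp only: gf_nth)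
  qed
  then have 1: "fps_nth (gf ?X sum_mset * distinct_gf) n
      = fps_nth ((\<Sum>w\<le>n. gf (crank_class k w) sum_mset) * distinct_gf) n"
    by (rule fps_mult_nth_cong)
  have "{P \<in> parts_in {0<..}. P = {#1#} \<and> sum_mset P = i} = (if i = 1 then {{#1#}} else {})" for i
    by (auto simp: parts_in_def)
  then have 2: "gf {P \<in> parts_in {0<..}. P = {#1#}} sum_mset = q"
    by (simp add: gf_def fps_eq_iff fps_X_def)
  have "{..n} = insert 0 {1..n}" by auto
  then have "(\<Sum>w\<le>n. gf (crank_class k w) sum_mset) + of_int c * q = (\<Sum>w\<le>n. (1 - q) * crank_term k w)"
    using gf_crank_class_0[of k] gf_crank_class_pos[of _ k] by (simp add: c_def)
  then have 3: "(\<Sum>w\<le>n. gf (crank_class k w) sum_mset) * distinct_gf + of_int c * (q * distinct_gf)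
      = pgf (odd_from 3) * (\<Sum>w\<le>n. crank_term k w)"
    unfolding distinct_gf_remove_1[symmetric] sum_distrib_left[symmetric] by algebra
  have "Mbar (int k) n = fps_nth (gf ?X sum_mset * distinct_gf) n + c * fps_nth (q * distinct_gf) n"
    unfolding Mbar_def first_residual_crank_def
      card_overpartitions_nonoverlined[of n "\<lambda>P. P \<noteq> {#1#} \<and> crank P = int k"]
      card_overpartitions_nonoverlined[of n "\<lambda>P. P = {#1#}"] 2
    by (simp add: c_def)
  also have "\<dots> = fps_nth ((\<Sum>w\<le>n. gf (crank_class k w) sum_mset) * distinct_gf
      + of_int c * (q * distinct_gf)) n"
    unfolding 1 by (simp add: fps_of_int[symmetric] flip: fps_const_def)
  finally show ?thesis unfolding 3 .
qed

theorem theorem1p4: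
  fixes m :: int and n :: nat
  assumes "m \<ge> 1"
  shows "Mbar (m - 1) n \<ge> Mbar m n \<longleftrightarrow> (m, n) \<notin> {(1, 1), (1, 2)}"
proof -
  define k where "k = nat (m - 1)"
  have k: "m = int (Suc k)" using assms by (simp add: k_def)
  have diff: "Mbar (m - 1) n - Mbar m n
      = fps_nth (pgf (odd_from 3) * (\<Sum>w\<le>n. crank_term k w - crank_term (Suc k) w)) n"
    using Mbar_eq[of k n] Mbar_eq[of "Suc k" n]
    by (simp add: k sum_subtractf right_diff_distrib)
  then have iff: "Mbar (m - 1) n \<ge> Mbar m n \<longleftrightarrow>
      0 \<le> fps_nth (pgf (odd_from 3) * (\<Sum>w\<le>n. crank_term k w - crank_term (Suc k) w)) n"
    by linarith
  show ?thesis
  \<comment> \<open>\<open>k = 0\<close> is \<open>m = 1\<close>, where the exceptions lie;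
    \<open>k = Suc M\<close> is \<open>m = M + 2\<close>.\<close>
  proof (cases k)
    case 0
    then show ?thesis unfolding iff using crank_term_diff0_nonneg_iff[of n] k by simp
  next
    case (Suc M)
    then show ?thesis unfolding iff using crank_term_diff_nonneg[of M n] k by simp
  qed
qed

end
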